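(* Let $\alpha_1,\alpha_3,\alpha_4\in\mathbb{F}_{p^m}^*$ be such that $\alpha_1+\alpha_3v+\alpha_4uv$ is not a cube in $\mathcal{R}$. Let $\mathcal{C}$ be an $(\alpha_1+\alpha_3v+\alpha_4uv)$-constacyclic code of length $3p^s$ over $\mathcal{R}$ (an ideal of $R_{\alpha_1,\alpha_3,\alpha_4}$) and let $\eta_{\mathcal{C}}$ be the number of codewords of $\mathcal{C}$. 1. (Type A) If $\mathcal{C}=\langle0\rangle$, then $Res(\mathcal{C})=\langle0\rangle=Tor(\mathcal{C})$ and $\eta_{\mathcal{C}}=1$. If $\mathcal{C}=\langle1\rangle$, then $Res(\mathcal{C})=\langle1\rangle=Tor(\mathcal{C})$ and $\eta_{\mathcal{C}}=p^{12mp^s}$. 2. (Type B) If $\mathcal{C}=\langle u(x^3-\alpha_0)^\ell\rangle$ with $0\le\ell\le2p^s-1$, then $Res(\mathcal{C})=\langle0\rangle$, $Tor(\mathcal{C})=\langle(x^3-\alpha_0)^\ell\rangle$ and $\eta_{\mathcal{C}}=p^{3m(2p^s-\ell)}$. 3. (Type C) If $\mathcal{C}=\langle(x^3-\alpha_0)^\ell\rangle$ with $1\le\ell\le2p^s-1$, then $Res(\mathcal{C})=\langle(x^3-\alpha_0)^\ell\rangle$, $Tor(\mathcal{C})=\langle(x^3-\alpha_0)^{\Im}\rangle$, where $\Im$ is the smallest non-negative integer such that $u(x^3-\alpha_0)^{\Im}\in\mathcal{C}$, and $\eta_{\mathcal{C}}=p^{6m(2p^s-\ell)}$. If $\mathcal{C}=\langle(x^3-\alpha_0)^\ell+u(x^3-\alpha_0)^tz(x)\rangle$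 with $1\le\ell\le2p^s-1$, $0\le t<\ell$ and $z(x)$ invertible, then $Res(\mathcal{C})=\langle(x^3-\alpha_0)^\ell\rangle$ and $Tor(\mathcal{C})=\langle(x^3-\alpha_0)^{\Im}\rangle$, where $\Im$ is the smallest non-negative integer such that $u(x^3-\alpha_0)^{\Im}\in\mathcal{C}$, which is given by $\Im=\min\{\ell,2p^s+t-\ell\}$. Thus $\eta_{\mathcal{C}}=p^{6m(2p^s-\ell)}$ if $1\le\ell\le p^s+\frac t2$, and $\eta_{\mathcal{C}}=p^{3m(2p^s-t)}$ if $p^s+\frac t2<\ell\le2p^s-1$. 4. (Type D) If $\mathcal{C}=\langle(x^3-\alpha_0)^\ell+u(x^3-\alpha_0)^tz(x),\,u(x^3-\alpha_0)^\mu\rangle$ with $1\le\ell\le2p^s-1$, $0\le t<\ell$, $z(x)$ either $0$ or invertible and involving only powers $(x^3-\alpha_0)^\kappa$ with $\kappa\le\mu-t-1$, and $0\le\mu<\Im$, where $\Im=\ell$ if $z(x)=0$ and $\Im=\min\{\ell,2p^s+t-\ell\}$ if $z(x)\ne0$, then $Res(\mathcal{C})=\langle(x^3-\alpha_0)^\ell\rangle$, $Tor(\mathcal{C})=\langle(x^3-\alpha_0)^\mu\rangle$, and $\eta_{\mathcal{C}}=p^{3m(4p^s-\ell-\mu)}$.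
   Context: $p\neq3$ is a prime, $m,s$ are positive integers, and $\mathcal{R}=\frac{\mathbb{F}_{p^m}[u,v]}{\langle u^2,v^2,uv-vu\rangle}=\mathbb{F}_{p^m}+u\mathbb{F}_{p^m}+v\mathbb{F}_{p^m}+uv\mathbb{F}_{p^m}$ with $u^2=v^2=0$, $uv=vu$. $R_{\alpha_1,\alpha_3,\alpha_4}=\frac{\mathcal{R}[x]}{\langle x^{3p^s}-(\alpha_1+\alpha_3v+\alpha_4uv)\rangle}$; its ideals are the $(\alpha_1+\alpha_3v+\alpha_4uv)$-constacyclic codes of length $3p^s$ over $\mathcal{R}$. Writing $s=q_0m+r_0$ with $q_0\ge0$ and $0\le r_0\le m-1$, put $\alpha_0=\alpha_1^{p^{m-r_0}}$, so that $\alpha_0^{p^s}=\alpha_1$. When $z(x)\ne0$ it is an invertible element of the form of a finite sum $z(x)=\sum_{\kappa\ge0}(z_{0\kappa}x^2+z_{1\kappa}x+z_{2\kappa})(x^3-\alpha_0)^\kappa$ with coefficients in $\mathbb{F}_{p^m}$ and $z_{00}x^2+z_{10}x+z_{20}\neq0$. Let $S=\frac{(\mathbb{F}_{p^m}+v\mathbb{F}_{p^m})[x]}{\langle x^{3p^s}-(\alpha_1+\alpha_3v)\rangle}$ (with $v^2=0$) and let $\psi_u:R_{\alpha_1,\alpha_3,\alpha_4}\to S$ be reduction modulo $u$. For an ideal $\mathcal{C}$, the residue is $Res(\mathcal{C})=\psi_u(\mathcal{C})$ and the torsion is $Tor(\mathcal{C})=\{a(x)\in S: ua(x)\in\mathcal{C}\}$;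 both are ideals of $S$, and the ideals displayed for $Res(\mathcal{C})$ and $Tor(\mathcal{C})$ are ideals of $S$. *)

theory Defs
  imports "HOL-Algebra.Algebraic_Closure_Type"
begin

text \<open>
  The type \<open>'a dual\<close> is \<open>A + eps A\<close> with \<open>eps\<^sup>2 = 0\<close>. Over a field \<open>F = 'a\<close>, the type
  \<open>'a dual\<close> is \<open>F + vF\<close>, and \<open>'a dual dual\<close> is \<open>(F + vF) + u(F + vF) = F[u,v]/(u\<^sup>2, v\<^sup>2, uv - vu)\<close>:
  the outer \<open>eps\<close> is \<open>u\<close> and the inner one is \<open>v\<close>.
\<close>

datatype 'a dual = Dual (base_part: 'a) (eps_part: 'a)

instantiation dual :: (comm_ring_1) comm_ring_1
begin

definition "0 = Dual 0 0"
definition "1 = Dual 1 0"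
definition "x + y = Dual (base_part x + base_part y) (eps_part x + eps_part y)"
definition "x - y = Dual (base_part x - base_part y) (eps_part x - eps_part y)"
definition "- x = Dual (- base_part x) (- eps_part x)"
definition "x * y = Dual (base_part x * base_part y)
                         (base_part x * eps_part y + eps_part x * base_part y)"

lemmas dual_defs = zero_dual_def one_dual_def plus_dual_def minus_dual_def uminus_dual_def
  times_dual_def

instance
  by standard (auto simp: dual_defs algebra_simps)

end

definition eps :: "'a::comm_ring_1 dual"
  where "eps = Dual 0 1"

definition of_base :: "'a::comm_ring_1 \<Rightarrow> 'a dual"
  where "of_base a = Dual a 0"

definition coeff_u :: "'a::comm_ring_1 dual dual"
  where "coeff_u = eps"

definition coeff_v :: "'a::comm_ring_1 dual dual"
  where "coeff_v = of_base eps"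

definition scalar :: "'a::comm_ring_1 \<Rightarrow> 'a dual dual"
  where "scalar a = of_base (of_base a)"

lemma base_part_simps [simp]:
  "base_part 0 = 0" "base_part 1 = 1" "base_part (x + y) = base_part x + base_part y"
  "base_part (x - y) = base_part x - base_part y" "base_part (- x) = - base_part x"
  "base_part (x * y) = base_part x * base_part y" "base_part eps = 0" "base_part (of_base a) = a"
  for x y :: "'a::comm_ring_1 dual"
  by (simp_all add: dual_defs eps_def of_base_def)

lemma of_base_simps [simp]:
  "of_base 0 = 0" "of_base 1 = 1" "of_base (a + b) = of_base a + of_base b"
  "of_base (a - b) = of_base a - of_base b" "of_base (- a) = - of_base a"
  "of_base (a * b) = of_base a * of_base b"
  for a b :: "'a::comm_ring_1"
  by (simp_all add: dual_defs of_base_def)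

lemma eps_square [simp]: "eps * eps = (0 :: 'a::comm_ring_1 dual)"
  by (simp add: dual_defs eps_def)

lemma coeff_u_square: "coeff_u\<^sup>2 = (0 :: 'a::comm_ring_1 dual dual)"
  by (simp add: coeff_u_def power2_eq_square)

lemma coeff_v_square: "coeff_v\<^sup>2 = (0 :: 'a::comm_ring_1 dual dual)"
  by (simp add: coeff_v_def power2_eq_square flip: of_base_simps)

lemma dual_dual_basis:
  fixes x :: "'a::comm_ring_1 dual dual"
  shows "\<exists>!(a, b, c, d).
    x = scalar a + coeff_u * scalar b + coeff_v * scalar c + coeff_u * coeff_v * scalar d"
proof -
  have "scalar a + coeff_u * scalar b + coeff_v * scalar c + coeff_u * coeff_v * scalar d
      = Dual (Dual a c) (Dual b d)" for a b c d :: 'a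
    by (simp add: dual_defs eps_def of_base_def scalar_def coeff_u_def coeff_v_def)
  then show ?thesis
    by (cases x rule: dual.exhaust, rename_tac y z, case_tac y, case_tac z) auto
qed

definition constacyclic_modulus :: "nat \<Rightarrow> 'b::comm_ring_1 \<Rightarrow> 'b poly set"
  where "constacyclic_modulus n \<gamma> =
    PIdl\<^bsub>ring_of_type_algebra\<^esub> (Polynomial.monom 1 n - [:\<gamma>:])"

text \<open>The quotient \<open>B[x]/(x\<^sup>n - \<gamma>)\<close>; its ideals are the \<open>\<gamma>\<close>-constacyclic codes of length \<open>n\<close>.\<close>

definition constacyclic_ring :: "nat \<Rightarrow> 'b::comm_ring_1 \<Rightarrow> 'b poly set ring"
  where "constacyclic_ring n \<gamma> = ring_of_type_algebra Quot constacyclic_modulus n \<gamma>"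

definition residue_class :: "nat \<Rightarrow> 'b::comm_ring_1 \<Rightarrow> 'b poly \<Rightarrow> 'b poly set"
  where "residue_class n \<gamma> f = constacyclic_modulus n \<gamma> +>\<^bsub>ring_of_type_algebra\<^esub> f"

text \<open>
  Maps on residue classes are written as unions over all representatives, as
  \<^const>\<open>rcoset_mult\<close> is in the library; the lemmas \<open>psi_u_residue_class\<close> and
  \<open>u_times_residue_class\<close> below show that the choice of representative does not matter.

  Note that \<open>of_base\<close> does not induce a ring homomorphism from \<open>S\<close> to \<open>R\<close> if \<open>\<gamma>\<close> has a
  nonzero \<open>u\<close>-component, but \<open>a \<mapsto> u a\<close> is a well-defined map from \<open>S\<close> to \<open>R\<close>, as \<open>u\<^sup>2 = 0\<close>.
\<close>

definition psi_u :: "nat \<Rightarrow> 'b::comm_ring_1 dual \<Rightarrow> 'b dual poly set \<Rightarrow> 'b poly set"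
  where "psi_u n \<gamma> A = (\<Union>f\<in>A. residue_class n (base_part \<gamma>) (map_poly base_part f))"

definition u_times :: "nat \<Rightarrow> 'b::comm_ring_1 dual \<Rightarrow> 'b poly set \<Rightarrow> 'b dual poly set"
  where "u_times n \<gamma> A = (\<Union>f\<in>A. residue_class n \<gamma> ([:eps:] * map_poly of_base f))"

definition Res :: "nat \<Rightarrow> 'b::comm_ring_1 dual \<Rightarrow> 'b dual poly set set \<Rightarrow> 'b poly set set"
  where "Res n \<gamma> C = psi_u n \<gamma> ` C"

definition Tor :: "nat \<Rightarrow> 'b::comm_ring_1 dual \<Rightarrow> 'b dual poly set set \<Rightarrow> 'b poly set set"
  where "Tor n \<gamma> C = {a \<in> carrier (constacyclic_ring n (base_part \<gamma>)). u_times n \<gamma> a \<in> C}"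

lemma mem_residue_class:
  "g \<in> residue_class n \<gamma> f \<longleftrightarrow> Polynomial.monom 1 n - [:\<gamma>:] dvd g - f"
proof -
  let ?q = "Polynomial.monom 1 n - [:\<gamma>:]"
  have "residue_class n \<gamma> f = (\<Union>k. {k * ?q + f})"
    by (auto simp: residue_class_def constacyclic_modulus_def cgenideal_def a_r_coset_def'
        ring_of_type_algebra_def)
  moreover have "g = k * ?q + f \<longleftrightarrow> g - f = ?q * k" for k
    by (simp only: diff_eq_eq mult.commute[of ?q])
  ultimately show ?thesis
    by (simp add: dvd_def)
qed

lemma residue_class_eqI:
  assumes "Polynomial.monom 1 n - [:\<gamma>:] dvd g - f"
  shows "residue_class n \<gamma> g = residue_class n \<gamma> f"
proof -
  have "Polynomial.monom 1 n - [:\<gamma>:] dvd h - g \<longleftrightarrow> Polynomial.monom 1 n - [:\<gamma>:] dvd h - f" for h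
    using dvd_add_left_iff[OF assms, of "h - g"] by simp
  then show ?thesis
    by (auto simp: mem_residue_class)
qed

lemma map_poly_mult_hom:
  fixes h :: "'b::comm_ring_1 \<Rightarrow> 'c::comm_ring_1"
  assumes "h 0 = 0" "\<And>a b. h (a + b) = h a + h b" "\<And>a b. h (a * b) = h a * h b"
  shows "map_poly h (f * g) = map_poly h f * map_poly h g"
proof -
  have "h (sum k A) = (\<Sum>i\<in>A. h (k i))" for k :: "nat \<Rightarrow> 'b" and A
    by (induction A rule: infinite_finite_induct) (auto simp: assms)
  then show ?thesis
    by (intro poly_eqI) (simp add: coeff_map_poly coeff_mult assms)
qed

lemma map_poly_diff_hom:
  fixes h :: "'b::comm_ring_1 \<Rightarrow> 'c::comm_ring_1"
  assumes "h 0 = 0" "\<And>a b. h (a - b) = h a - h b"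
  shows "map_poly h (f - g) = map_poly h f - map_poly h g"
  by (intro poly_eqI) (simp add: coeff_map_poly assms)

lemma psi_u_residue_class:
  "psi_u n \<gamma> (residue_class n \<gamma> f) = residue_class n (base_part \<gamma>) (map_poly base_part f)"
proof -
  have "residue_class n (base_part \<gamma>) (map_poly base_part g)
      = residue_class n (base_part \<gamma>) (map_poly base_part f)"
    if g: "g \<in> residue_class n \<gamma> f" for g
  proof (rule residue_class_eqI)
    obtain k where "g - f = (Polynomial.monom 1 n - [:\<gamma>:]) * k"
      using g unfolding mem_residue_class dvd_def by blast
    then have "map_poly base_part (g - f) =
        map_poly base_part (Polynomial.monom 1 n - [:\<gamma>:]) * map_poly base_part k"
      by (simp only: map_poly_mult_hom base_part_simps)
    then show "Polynomial.monom 1 n - [:base_part \<gamma>:]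
        dvd map_poly base_part g - map_poly base_part f"
      by (simp add: map_poly_diff_hom map_poly_monom map_poly_pCons)
  qed
  moreover have "f \<in> residue_class n \<gamma> f"
    by (simp add: mem_residue_class)
  ultimately show ?thesis
    unfolding psi_u_def by blast
qed

lemma u_times_residue_class:
  "u_times n \<gamma> (residue_class n (base_part \<gamma>) f) = residue_class n \<gamma> ([:eps:] * map_poly of_base f)"
proof -
  have "residue_class n \<gamma> ([:eps:] * map_poly of_base g)
      = residue_class n \<gamma> ([:eps:] * map_poly of_base f)"
    if g: "g \<in> residue_class n (base_part \<gamma>) f" for g
  proof (rule residue_class_eqI)
    obtain k where k: "g - f = (Polynomial.monom 1 n - [:base_part \<gamma>:]) * k"
      using g unfolding mem_residue_class dvd_def by blast
    have "eps * of_base (base_part \<gamma>) = eps * \<gamma>"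
      by (simp add: eps_def of_base_def times_dual_def)
    then have eps: "[:eps:] * (Polynomial.monom 1 n - [:of_base (base_part \<gamma>):])
        = [:eps:] * (Polynomial.monom 1 n - [:\<gamma>:])"
      by (simp add: algebra_simps)
    have "map_poly of_base (g - f) =
        map_poly of_base (Polynomial.monom 1 n - [:base_part \<gamma>:]) * map_poly of_base k"
      unfolding k by (rule map_poly_mult_hom) simp_all
    then have "map_poly of_base g - map_poly of_base f =
        (Polynomial.monom 1 n - [:of_base (base_part \<gamma>):]) * map_poly of_base k"
      by (simp add: map_poly_diff_hom map_poly_monom map_poly_pCons)
    then have "[:eps:] * (map_poly of_base g - map_poly of_base f) =
        [:eps:] * (Polynomial.monom 1 n - [:\<gamma>:]) * map_poly of_base k"
      by (simp only: eps mult.assoc[symmetric])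
    then have "[:eps:] * map_poly of_base g - [:eps:] * map_poly of_base f =
        (Polynomial.monom 1 n - [:\<gamma>:]) * ([:eps:] * map_poly of_base k)"
      by (simp only: right_diff_distrib[of "[:eps:]" "map_poly of_base g", symmetric]
          mult.assoc mult.left_commute[of "[:eps:]"])
    then show "Polynomial.monom 1 n - [:\<gamma>:]
        dvd [:eps:] * map_poly of_base g - [:eps:] * map_poly of_base f"
      by (rule dvdI)
  qed
  moreover have "f \<in> residue_class n (base_part \<gamma>) f"
    by (simp add: mem_residue_class)
  ultimately show ?thesis
    unfolding u_times_def by blast
qed

text \<open>
  The set \<open>A\<close> bounds the exponents \<open>\<kappa>\<close> that may occur in \<open>z\<close>. The condition \<open>0 \<in> K\<close> makes
  \<open>z\<^sub>0\<^sub>0 x\<^sup>2 + z\<^sub>1\<^sub>0 x + z\<^sub>2\<^sub>0\<close> a term of the sum; so there is no such \<open>z\<close> if \<open>0 \<notin> A\<close>.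
\<close>

definition unit_expansion ::
  "nat \<Rightarrow> 'a::field dual dual \<Rightarrow> 'a \<Rightarrow> nat set \<Rightarrow> 'a dual dual poly set \<Rightarrow> bool"
  where "unit_expansion n \<gamma> \<alpha>\<^sub>0 A z \<longleftrightarrow>
    z \<in> Units (constacyclic_ring n \<gamma>) \<and>
    (\<exists>K z\<^sub>0 z\<^sub>1 z\<^sub>2. finite K \<and> 0 \<in> K \<and> K \<subseteq> A \<and> [:z\<^sub>2 0, z\<^sub>1 0, z\<^sub>0 0:] \<noteq> 0 \<and>
      z = residue_class n \<gamma> (map_poly scalar
            (\<Sum>\<kappa>\<in>K. [:z\<^sub>2 \<kappa>, z\<^sub>1 \<kappa>, z\<^sub>0 \<kappa>:] * (Polynomial.monom 1 3 - [:\<alpha>\<^sub>0:]) ^ \<kappa>)))"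

end

theory Submission
  imports Defs "HOL-Algebra.Multiplicative_Group"
begin

text \<open>
  Put \<open>f = x\<^sup>3 - \<alpha>\<^sub>0\<close> and \<open>N = 2p^s\<close>. Taking \<open>p^s\<close>-th powers is additive in characteristic \<open>p\<close>, and
  \<open>\<alpha>\<^sub>0^(p^s) = \<alpha>\<^sub>1\<close>; hence \<open>f^(p^s) = x^(3p^s) - \<alpha>\<^sub>1\<close>, and in the ring \<open>R\<close> of the codes this power
  becomes \<open>v(\<alpha>\<^sub>3 + \<alpha>\<^sub>4 u)\<close>. Since \<open>\<alpha>\<^sub>3 + \<alpha>\<^sub>4 u\<close> is a unit, \<open>v\<close> is redundant as a generator, and the
  relation \<open>v\<^sup>2 = 0\<close> turns into \<open>f^N = 0\<close>. So \<open>R = T[u]/(u\<^sup>2)\<close> and, modulo \<open>u\<close>, \<open>S = T\<close>, where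
  \<open>T = F[x]/(f^N)\<close>; this is \<open>square_zero_perturbation\<close>, applied in
  \<open>constacyclic_presentation\<close>. The isomorphisms identify reduction modulo \<open>u\<close> with
  \<open>a + ub \<mapsto> a\<close>, and multiplication by \<open>u\<close> from \<open>S\<close> to \<open>R\<close> with \<open>b \<mapsto> ub\<close>.

  In \<open>T[u]\<close> every code of the theorem has the form \<open>\<langle>f^l + uw, u f^\<mu>\<rangle>\<close> with \<open>\<mu> \<le> l \<le> N\<close>. Its residue
  is \<open>\<langle>f^l\<rangle>\<close>. A multiple \<open>(a + ub)(f^l + uw)\<close> of the first generator lies in \<open>uT\<close> only if \<open>f^(N - l)\<close>
  divides \<open>a\<close>, so the torsion is exactly \<open>\<langle>f^\<mu>\<rangle>\<close> as soon as \<open>f^\<mu>\<close> divides \<open>f^(N - l) w\<close>. Division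
  with remainder then parametrises the codewords by a remainder modulo \<open>f^(N - l)\<close> and one modulo
  \<open>f^(N - \<mu>)\<close>, and so gives their number (\<open>card_code\<close>).

  The types differ only in \<open>l\<close>, \<open>w\<close> and \<open>\<mu>\<close>. For a single generator \<open>f^l + u f^t z\<close> the torsion has to
  be found first: multiplication by \<open>u\<close> gives \<open>u f^l\<close>, and multiplication by \<open>f^(N - l) z\<^sup>-\<^sup>1\<close>
  gives \<open>u f^(N + t - l)\<close>, whence \<open>\<mu> = min l (N + t - l)\<close> (\<open>unit_twist_eq_pair\<close>).
\<close>

section \<open>Surjections from a ring in a type class onto a ring with a carrier\<close>

locale type_ring_surjection = ring_hom_cring ring_of_type_algebra R h
  for R :: "('r, 'e) ring_scheme" (structure) and h :: "'b::comm_ring_1 \<Rightarrow> 'r" +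
  assumes surj: "carrier R = range h"
begin

lemma hom_simps:
  "h (a + b) = h a \<oplus>\<^bsub>R\<^esub> h b" "h (a * b) = h a \<otimes>\<^bsub>R\<^esub> h b" "h 0 = \<zero>\<^bsub>R\<^esub>" "h 1 = \<one>\<^bsub>R\<^esub>"
  using hom_add[of a b] hom_mult[of a b] hom_zero hom_one
  by (simp_all add: ring_of_type_algebra_def del: hom_add hom_mult hom_zero hom_one)

lemma in_carrier [simp]: "h a \<in> carrier R"
  by (simp add: surj)

lemma hom_power: "h (a ^ k) = h a [^]\<^bsub>R\<^esub> k"
  by (induction k) (simp_all add: hom_simps power_Suc2 del: power_Suc)

lemma hom_uminus: "h (- a) = \<ominus>\<^bsub>R\<^esub> h a"
proof -
  have "h (- a) \<oplus>\<^bsub>R\<^esub> h a = \<zero>\<^bsub>R\<^esub>"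
    by (simp only: hom_simps(1,3)[symmetric]) simp
  then show ?thesis
    using S.minus_equality[of "h (- a)" "h a"] by simp
qed

lemma eq_iff_diff: "h a = h b \<longleftrightarrow> h (a - b) = \<zero>\<^bsub>R\<^esub>"
proof -
  have "h (a - b) = h a \<ominus>\<^bsub>R\<^esub> h b"
    using hom_simps(1)[of a "- b"] by (simp add: hom_uminus S.minus_eq)
  then show ?thesis
    by simp
qed

lemma genideal_pair: "Idl\<^bsub>R\<^esub> {h a, h b} = {h (a * x + b * y) | x y. True}"
proof (rule antisym)
  have "ideal {h (a * x + b * y) | x y. True} R" (is "ideal ?I R")
  proof (rule idealI)
    show "subgroup ?I (add_monoid R)"
    proof
      fix s t assume "s \<in> ?I" "t \<in> ?I"
      then obtain x y x' y' where "s = h (a * x + b * y)" "t = h (a * x' + b * y')"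
        by blast
      then have "s \<otimes>\<^bsub>add_monoid R\<^esub> t = h (a * (x + x') + b * (y + y'))"
        by (simp add: hom_simps(1)[symmetric]) (simp add: algebra_simps)
      then show "s \<otimes>\<^bsub>add_monoid R\<^esub> t \<in> ?I"
        by blast
    next
      have "\<one>\<^bsub>add_monoid R\<^esub> = h (a * 0 + b * 0)"
        by (simp add: hom_simps(3))
      then show "\<one>\<^bsub>add_monoid R\<^esub> \<in> ?I"
        by blast
    next
      fix s assume "s \<in> ?I"
      then obtain x y where "s = h (a * x + b * y)"
        by blast
      then have "inv\<^bsub>add_monoid R\<^esub> s = h (a * (- x) + b * (- y))"
        using hom_uminus[of "a * x + b * y"] by (simp add: a_inv_def)
      then show "inv\<^bsub>add_monoid R\<^esub> s \<in> ?I"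
        by blast
    qed auto
  next
    fix s t assume "s \<in> ?I" "t \<in> carrier R"
    then obtain x y z where st: "s = h (a * x + b * y)" "t = h z"
      using surj by blast
    then have "t \<otimes>\<^bsub>R\<^esub> s = h (a * (x * z) + b * (y * z))" "s \<otimes>\<^bsub>R\<^esub> t = h (a * (x * z) + b * (y * z))"
      by (simp_all only: hom_simps(2)[symmetric]) (simp_all only: distrib_left distrib_right ac_simps)
    then show "t \<otimes>\<^bsub>R\<^esub> s \<in> ?I" "s \<otimes>\<^bsub>R\<^esub> t \<in> ?I"
      by blast+
  qed (rule S.ring_axioms)
  moreover have "h a = h (a * 1 + b * 0)" "h b = h (a * 0 + b * 1)"
    by simp_all
  then have "{h a, h b} \<subseteq> {h (a * x + b * y) | x y. True}"
    by blast
  ultimately show "Idl\<^bsub>R\<^esub> {h a, h b} \<subseteq> {h (a * x + b * y) | x y. True}"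
    by (rule S.genideal_minimal)
next
  interpret I: ideal "Idl\<^bsub>R\<^esub> {h a, h b}" R
    by (rule S.genideal_ideal) auto
  have "h a \<in> Idl\<^bsub>R\<^esub> {h a, h b}" "h b \<in> Idl\<^bsub>R\<^esub> {h a, h b}"
    using S.genideal_self[of "{h a, h b}"] by auto
  then show "{h (a * x + b * y) | x y. True} \<subseteq> Idl\<^bsub>R\<^esub> {h a, h b}"
    unfolding hom_simps by (auto simp: I.a_closed I.I_r_closed)
qed

lemma genideal_single: "Idl\<^bsub>R\<^esub> {h a} = {h (a * x) | x. True}"
proof -
  have "h (a * x) = h (a * x + a * 0)" for x
    by simp
  then show ?thesis
    using genideal_pair[of a a] by (simp only: distrib_left[symmetric] insert_absorb2) blast
qed

text \<open>
  A redundant generator can be added; this lets ideals with one generator be treated as ideals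
  with two.
\<close>

lemma genideal_single_eq_pair:
  assumes "h b = h (a * c)"
  shows "Idl\<^bsub>R\<^esub> {h a} = Idl\<^bsub>R\<^esub> {h a, h b}"
proof -
  have "h (a * x + b * y) = h (a * (x + c * y))" for x y
    by (simp only: distrib_left mult.assoc[symmetric] hom_simps(1)) (simp only: hom_simps(2) assms)
  moreover have "h (a * x) = h (a * x + b * 0)" for x
    by simp
  ultimately show ?thesis
    unfolding genideal_single genideal_pair by blast
qed

end

lemma residue_class_surjection:
  fixes \<gamma> :: "'b::comm_ring_1"
  shows "type_ring_surjection (constacyclic_ring n \<gamma>) (residue_class n \<gamma>)"
proof -
  let ?T = "ring_of_type_algebra :: 'b poly ring"
  interpret T: cring ?T
    by (rule cring_from_type_algebra)
  interpret ideal "constacyclic_modulus n \<gamma>" ?T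
    unfolding constacyclic_modulus_def
    by (rule T.cgenideal_ideal) (simp add: ring_of_type_algebra_def)
  have rc: "residue_class n \<gamma> = (+>\<^bsub>?T\<^esub>) (constacyclic_modulus n \<gamma>)"
    by (simp add: residue_class_def fun_eq_iff)
  interpret ring_hom_cring ?T "constacyclic_ring n \<gamma>" "residue_class n \<gamma>"
    unfolding constacyclic_ring_def rc
    by (rule rcos_ring_hom_cring) (rule T.is_cring)
  show ?thesis
  proof
    show "carrier (constacyclic_ring n \<gamma>) = range (residue_class n \<gamma>)"
      unfolding constacyclic_ring_def FactRing_simps rc by (auto simp: ring_of_type_algebra_def)
  qed
qed

lemma residue_class_eq_iff:
  "residue_class n \<gamma> g = residue_class n \<gamma> h \<longleftrightarrow> Polynomial.monom 1 n - [:\<gamma>:] dvd g - h"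
  by (metis mem_residue_class residue_class_eqI diff_self dvd_0_right)

section \<open>A square-zero perturbation of a modulus\<close>

text \<open>
  Modulo \<open>Q\<close> one has \<open>v = \<iota> (P / c)\<close>, so that every element is congruent to one in the image of \<open>\<iota>\<close>,
  and \<open>v\<^sup>2 = 0\<close> turns into \<open>P\<^sup>2 = 0\<close>. Hence the quotient of \<open>A + vA\<close> by \<open>Q\<close> is the quotient of \<open>A\<close>
  by \<open>P\<^sup>2\<close>.
\<close>

lemma square_zero_perturbation:
  fixes \<iota> :: "'r::comm_ring_1 \<Rightarrow> 's::comm_ring_1"
  assumes add: "\<And>a b. \<iota> (a + b) = \<iota> a + \<iota> b" and mult: "\<And>a b. \<iota> (a * b) = \<iota> a * \<iota> b"
    and v: "v * v = 0"
    and decomposition: "\<And>x. \<exists>a b. x = \<iota> a + v * \<iota> b"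
    and independence: "\<And>a b a' b'. \<iota> a + v * \<iota> b = \<iota> a' + v * \<iota> b' \<Longrightarrow> a = a' \<and> b = b'"
    and unit: "c * d = 1" and Q: "Q = \<iota> P - v * \<iota> c"
  shows "\<exists>a. Q dvd x - \<iota> a" and "Q dvd \<iota> a \<longleftrightarrow> P\<^sup>2 dvd a"
proof -
  have diff: "\<iota> (a - b) = \<iota> a - \<iota> b" for a b
    using add[of "a - b" b] by simp
  show "\<exists>a. Q dvd x - \<iota> a"
  proof -
    obtain a b where x: "x = \<iota> a + v * \<iota> b"
      using decomposition by blast
    have "b = c * (d * b)"
      using unit by (simp flip: mult.assoc)
    then have "\<iota> b = \<iota> c * \<iota> (d * b)"
      by (metis mult)
    then have "x - \<iota> (a + P * (d * b)) = Q * (- \<iota> (d * b))"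
      by (simp add: x Q add mult algebra_simps)
    then show ?thesis
      by (metis dvdI)
  qed
  show "Q dvd \<iota> a \<longleftrightarrow> P\<^sup>2 dvd a"
  proof
    assume "Q dvd \<iota> a"
    then obtain k where k: "\<iota> a = Q * k" ..
    obtain k0 k1 where "k = \<iota> k0 + v * \<iota> k1"
      using decomposition by blast
    then have "Q * k = \<iota> P * \<iota> k0 + v * (\<iota> P * \<iota> k1 - \<iota> c * \<iota> k0) - (v * v) * (\<iota> c * \<iota> k1)"
      by (simp add: Q algebra_simps)
    then have "\<iota> a + v * \<iota> 0 = \<iota> (P * k0) + v * \<iota> (P * k1 - c * k0)"
      using k v diff[of 0 0] by (simp add: mult diff)
    then have a: "a = P * k0" and "P * k1 = c * k0"
      using independence by fastforce+
    then have "k0 = P * (d * k1)"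
      using unit by (metis mult.commute mult.left_commute mult.right_neutral)
    then show "P\<^sup>2 dvd a"
      by (simp add: a power2_eq_square mult.assoc mult_dvd_mono)
  next
    assume "P\<^sup>2 dvd a"
    then obtain b where "a = P * P * b"
      unfolding power2_eq_square ..
    have "\<iota> P * \<iota> P = Q * (Q + 2 * v * \<iota> c) + v * v * \<iota> c * \<iota> c"
      by (simp add: Q algebra_simps)
    then have "\<iota> P * \<iota> P = Q * (Q + 2 * v * \<iota> c)"
      by (simp add: v)
    with \<open>a = P * P * b\<close> have "\<iota> a = Q * ((Q + 2 * v * \<iota> c) * \<iota> b)"
      by (simp only: mult mult.assoc[symmetric])
    then show "Q dvd \<iota> a" ..
  qed
qed

lemma map_poly_add_hom:
  fixes h :: "'b::comm_ring_1 \<Rightarrow> 'c::comm_ring_1"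
  assumes "h 0 = 0" "\<And>a b. h (a + b) = h a + h b"
  shows "map_poly h (f + g) = map_poly h f + map_poly h g"
  by (intro poly_eqI) (simp add: coeff_map_poly assms)

text \<open>The inclusion of \<open>F[x][u]\<close> into \<open>(F + uF + vF + uvF)[x]\<close>.\<close>

definition poly_of_dual :: "'a::comm_ring_1 poly dual \<Rightarrow> 'a dual dual poly"
  where "poly_of_dual A =
    map_poly scalar (base_part A) + [:coeff_u:] * map_poly scalar (eps_part A)"

lemma coeff_poly_of_dual:
  "coeff (poly_of_dual A) i = Dual (Dual (coeff (base_part A) i) 0) (Dual (coeff (eps_part A) i) 0)"
  by (simp add: poly_of_dual_def coeff_map_poly scalar_def)
    (simp add: dual_defs of_base_def coeff_u_def eps_def)

lemma poly_of_dual_hom: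
  fixes A B :: "'a::comm_ring_1 poly dual"
  shows "poly_of_dual (A + B) = poly_of_dual A + poly_of_dual B"
    and "poly_of_dual (A * B) = poly_of_dual A * poly_of_dual B"
    and "poly_of_dual (1 :: 'a poly dual) = 1"
proof -
  have scalar: "scalar (0::'a) = 0" "scalar (a + b) = scalar a + scalar b"
    "scalar (a * b) = scalar a * scalar b" for a b :: 'a
    by (simp_all add: scalar_def)
  have u: "[:coeff_u:] * [:coeff_u:] = (0 :: 'a dual dual poly)"
    using coeff_u_square[where ?'a = 'a] by (simp add: power2_eq_square)
  have "(a + U * b) * (a' + U * b') = a * a' + U * (a * b' + b * a')" if "U * U = 0"
    for a b a' b' U :: "'a dual dual poly"
  proof -
    have "(a + U * b) * (a' + U * b') = a * a' + U * (a * b' + b * a') + U * U * (b * b')"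
      by (simp only: distrib_left distrib_right ac_simps)
    then show ?thesis
      by (simp add: that)
  qed
  then show "poly_of_dual (A * B) = poly_of_dual A * poly_of_dual B"
    using u unfolding poly_of_dual_def
    by (simp only: times_dual_def dual.sel map_poly_mult_hom map_poly_add_hom scalar)
  show "poly_of_dual (A + B) = poly_of_dual A + poly_of_dual B"
    by (rule poly_eqI) (simp add: coeff_poly_of_dual dual_defs)
  show "poly_of_dual 1 = (1 :: 'a dual dual poly)"
    by (rule poly_eqI) (simp add: coeff_poly_of_dual one_dual_def zero_dual_def coeff_pCons
        one_pCons split: nat.split)
qed

text \<open>
  Elimination of \<open>v\<close> when \<open>u\<close> is present: the perturbation \<open>\<alpha>\<^sub>3 + \<alpha>\<^sub>4 u\<close> is invertible in \<open>F[x][u]\<close>,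
  being a nonzero constant plus a nilpotent, and divisibility by \<open>P\<^sup>2\<close> in \<open>F[x][u]\<close> is divisibility
  of both components.
\<close>

lemma perturbation_over_dual_dual:
  fixes P :: "'a::field poly" and \<alpha>\<^sub>3 \<alpha>\<^sub>4 :: 'a
  assumes "\<alpha>\<^sub>3 \<noteq> 0"
    and Q: "Q = map_poly scalar P - [:scalar \<alpha>\<^sub>3 * coeff_v + scalar \<alpha>\<^sub>4 * coeff_u * coeff_v:]"
  shows "\<exists>A. Q dvd g - poly_of_dual A"
    and "Q dvd poly_of_dual (Dual a b) \<longleftrightarrow> P\<^sup>2 dvd a \<and> P\<^sup>2 dvd b"
proof -
  have coeff_v_mult: "coeff ([:coeff_v:] * poly_of_dual A) i =
      Dual (Dual 0 (coeff (base_part A) i)) (Dual 0 (coeff (eps_part A) i))"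
    for A :: "'a poly dual" and i
    by (simp add: coeff_poly_of_dual) (simp add: dual_defs of_base_def coeff_v_def eps_def)
  have v: "[:coeff_v:] * [:coeff_v:] = (0 :: 'a dual dual poly)"
    using coeff_v_square[where ?'a = 'a] by (simp add: power2_eq_square)
  have decomposition: "\<exists>A B. g = poly_of_dual A + [:coeff_v:] * poly_of_dual B"
    for g :: "'a dual dual poly"
  proof (intro exI)
    let ?A = "Dual (map_poly (\<lambda>x. base_part (base_part x)) g)
      (map_poly (\<lambda>x. base_part (eps_part x)) g)"
    let ?B = "Dual (map_poly (\<lambda>x. eps_part (base_part x)) g)
      (map_poly (\<lambda>x. eps_part (eps_part x)) g)"
    show "g = poly_of_dual ?A + [:coeff_v:] * poly_of_dual ?B"
      by (rule poly_eqI, unfold coeff_add coeff_v_mult)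
        (simp add: coeff_poly_of_dual coeff_map_poly dual_defs)
  qed
  have independence: "A = A' \<and> B = B'"
    if eq: "poly_of_dual A + [:coeff_v:] * poly_of_dual B =
      poly_of_dual A' + [:coeff_v:] * poly_of_dual B'" for A B A' B' :: "'a poly dual"
  proof -
    have "coeff (poly_of_dual A) i + coeff ([:coeff_v:] * poly_of_dual B) i =
        coeff (poly_of_dual A') i + coeff ([:coeff_v:] * poly_of_dual B') i" for i
      using eq by (metis coeff_add)
    then show ?thesis
      unfolding coeff_v_mult coeff_poly_of_dual
      by (auto simp: dual_defs poly_eq_iff intro!: dual.expand)
  qed
  have unit: "Dual [:\<alpha>\<^sub>3:] [:\<alpha>\<^sub>4:] * Dual [:1 / \<alpha>\<^sub>3:] [:- \<alpha>\<^sub>4 / \<alpha>\<^sub>3\<^sup>2:] = 1"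
    using \<open>\<alpha>\<^sub>3 \<noteq> 0\<close> by (simp add: dual_defs one_pCons power2_eq_square)
  have "[:scalar \<alpha>\<^sub>3 * coeff_v + scalar \<alpha>\<^sub>4 * coeff_u * coeff_v:] =
      [:coeff_v:] * poly_of_dual (Dual [:\<alpha>\<^sub>3:] [:\<alpha>\<^sub>4:])"
    by (simp add: poly_of_dual_def map_poly_pCons scalar_def algebra_simps)
  moreover have "map_poly scalar P = poly_of_dual (Dual P 0)"
    by (simp add: poly_of_dual_def)
  ultimately have Q': "Q = poly_of_dual (Dual P 0) - [:coeff_v:] * poly_of_dual (Dual [:\<alpha>\<^sub>3:] [:\<alpha>\<^sub>4:])"
    by (simp add: Q)
  note perturbation =
    square_zero_perturbation[OF poly_of_dual_hom(1,2) v decomposition independence unit Q', simplified]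
  show "\<exists>A. Q dvd g - poly_of_dual A"
    by (rule perturbation)
  have "(Dual P 0)\<^sup>2 dvd Dual a b \<longleftrightarrow> P\<^sup>2 dvd a \<and> P\<^sup>2 dvd b"
  proof
    assume "(Dual P 0)\<^sup>2 dvd Dual a b"
    then obtain Z where "Dual a b = (Dual P 0)\<^sup>2 * Z" ..
    then show "P\<^sup>2 dvd a \<and> P\<^sup>2 dvd b"
      by (simp add: power2_eq_square times_dual_def)
  next
    assume "P\<^sup>2 dvd a \<and> P\<^sup>2 dvd b"
    then obtain a' b' where "a = P\<^sup>2 * a'" "b = P\<^sup>2 * b'"
      by (auto simp: dvd_def)
    then have "Dual a b = (Dual P 0)\<^sup>2 * Dual a' b'"
      by (simp add: power2_eq_square times_dual_def)
    then show "(Dual P 0)\<^sup>2 dvd Dual a b" ..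
  qed
  then show "Q dvd poly_of_dual (Dual a b) \<longleftrightarrow> P\<^sup>2 dvd a \<and> P\<^sup>2 dvd b"
    by (simp add: perturbation)
qed

lemma perturbation_over_dual:
  fixes P :: "'a::field poly" and \<alpha>\<^sub>3 :: 'a
  assumes "\<alpha>\<^sub>3 \<noteq> 0" and Q: "Q = map_poly of_base P - [:of_base \<alpha>\<^sub>3 * eps:]"
  shows "\<exists>a. Q dvd g - map_poly of_base a" and "Q dvd map_poly of_base a \<longleftrightarrow> P\<^sup>2 dvd a"
proof -
  have coeff_eps_mult: "coeff ([:eps:] * map_poly of_base a) i = Dual 0 (coeff a i)"
    for a :: "'a poly" and i
    by (simp add: coeff_map_poly) (simp add: dual_defs of_base_def eps_def)
  have eps: "[:eps:] * [:eps:] = (0 :: 'a dual poly)"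
    by simp
  have decomposition: "\<exists>a b. g = map_poly of_base a + [:eps:] * map_poly of_base b"
    for g :: "'a dual poly"
  proof (intro exI)
    show "g = map_poly of_base (map_poly base_part g) +
        [:eps:] * map_poly of_base (map_poly eps_part g)"
      by (rule poly_eqI, unfold coeff_add coeff_eps_mult)
        (simp add: coeff_map_poly of_base_def dual_defs)
  qed
  have independence: "a = a' \<and> b = b'"
    if eq: "map_poly of_base a + [:eps:] * map_poly of_base b =
      map_poly of_base a' + [:eps:] * map_poly of_base b'" for a b a' b' :: "'a poly"
  proof -
    have "coeff (map_poly of_base a) i + coeff ([:eps:] * map_poly of_base b) i =
        coeff (map_poly of_base a') i + coeff ([:eps:] * map_poly of_base b') i" for i
      using eq by (metis coeff_add)
    then show ?thesis
      unfolding coeff_eps_mult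
      by (auto simp: dual_defs coeff_map_poly of_base_def poly_eq_iff)
  qed
  have unit: "[:\<alpha>\<^sub>3:] * [:1 / \<alpha>\<^sub>3:] = 1"
    using \<open>\<alpha>\<^sub>3 \<noteq> 0\<close> by (simp add: one_pCons)
  have Q': "Q = map_poly of_base P - [:eps:] * map_poly of_base [:\<alpha>\<^sub>3:]"
    by (simp add: Q map_poly_pCons mult.commute)
  have hom: "map_poly of_base (a + b) = map_poly of_base a + map_poly of_base b"
    "map_poly of_base (a * b) = map_poly of_base a * map_poly of_base b"
    for a b :: "'a poly"
    by (simp_all add: map_poly_add_hom map_poly_mult_hom)
  note perturbation =
    square_zero_perturbation[OF hom eps decomposition independence unit Q', simplified]
  show "\<exists>a. Q dvd g - map_poly of_base a" "Q dvd map_poly of_base a \<longleftrightarrow> P\<^sup>2 dvd a"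
    by (rule perturbation)+
qed

section \<open>Ideals of \<open>T[u]\<close> for \<open>T = F[x]/(f^N)\<close>\<close>

definition polys_below :: "nat \<Rightarrow> 'a::zero poly set"
  where "polys_below k = {a. \<forall>i\<ge>k. coeff a i = 0}"

lemma card_polys_below:
  "card (polys_below k :: 'a::{zero,finite} poly set) = card (UNIV :: 'a set) ^ k"
proof (induction k)
  case 0
  have "polys_below 0 = {0 :: 'a poly}"
    by (auto simp: polys_below_def poly_eq_iff)
  then show ?case
    by simp
next
  case (Suc k)
  have "polys_below (Suc k) = (\<lambda>(c, a). pCons c a) ` (UNIV \<times> (polys_below k :: 'a poly set))"
  proof (intro Set.set_eqI iffI)
    fix a :: "'a poly" assume a: "a \<in> polys_below (Suc k)"
    obtain c b where "a = pCons c b"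
      by (cases a)
    then show "a \<in> (\<lambda>(c, a). pCons c a) ` (UNIV \<times> polys_below k)"
      using a by (force simp: polys_below_def coeff_pCons)
  qed (auto simp: polys_below_def coeff_pCons split: nat.split)
  moreover have "inj_on (\<lambda>(c, a). pCons c a) (UNIV \<times> (polys_below k :: 'a poly set))"
    by (auto simp: inj_on_def)
  ultimately show ?case
    using Suc by (simp add: card_image card_cartesian_product)
qed

lemma mod_in_polys_below:
  fixes a g :: "'a::field poly"
  assumes "g \<noteq> 0"
  shows "a mod g \<in> polys_below (degree g)"
  using degree_mod_less[OF assms, of a] by (auto simp: polys_below_def intro: coeff_eq_0)

lemma polys_below_congruent_eq:
  fixes a b g :: "'a::field poly"
  assumes "a \<in> polys_below (degree g)" "b \<in> polys_below (degree g)" "g dvd a - b"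
  shows "a = b"
proof (rule ccontr)
  assume "a \<noteq> b"
  then have "degree g \<le> degree (a - b)"
    using assms by (intro dvd_imp_degree_le) auto
  then have "coeff (a - b) (degree (a - b)) = 0"
    using assms by (simp add: polys_below_def)
  then show False
    using \<open>a \<noteq> b\<close> by (metis leading_coeff_0_iff right_minus_eq)
qed

text \<open>
  The ring \<open>R\<close> is presented as \<open>T[u]\<close> and \<open>S\<close> as \<open>T\<close>; the maps \<open>reduction\<close> and \<open>u_embedding\<close> are
  \<open>a + ub \<mapsto> a\<close> and \<open>b \<mapsto> ub\<close>.
\<close>

locale dual_presentation =
  Phi: type_ring_surjection R \<Phi> + Psi: type_ring_surjection S \<Psi>
  for R :: "'r ring" and \<Phi> :: "'a::{field,finite} poly dual \<Rightarrow> 'r"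
    and S :: "'s ring" and \<Psi> :: "'a poly \<Rightarrow> 's" +
  fixes f :: "'a poly" and N :: nat
    and reduction :: "'r \<Rightarrow> 's" and u_embedding :: "'s \<Rightarrow> 'r"
  assumes degree_f: "degree f > 0"
    and Phi_kernel: "\<And>a b. \<Phi> (Dual a b) = \<zero>\<^bsub>R\<^esub> \<longleftrightarrow> f ^ N dvd a \<and> f ^ N dvd b"
    and Psi_kernel: "\<And>a. \<Psi> a = \<zero>\<^bsub>S\<^esub> \<longleftrightarrow> f ^ N dvd a"
    and reduction: "\<And>a b. reduction (\<Phi> (Dual a b)) = \<Psi> a"
    and u_embedding: "\<And>b. u_embedding (\<Psi> b) = \<Phi> (Dual 0 b)"
begin

lemma f_nonzero [simp]: "f \<noteq> 0"
  using degree_f by auto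

lemma power_f_dvd_iff: "f ^ i dvd f ^ j \<longleftrightarrow> i \<le> j"
proof
  assume "f ^ i dvd f ^ j"
  then have "degree (f ^ i) \<le> degree (f ^ j)"
    by (intro dvd_imp_degree_le) auto
  then show "i \<le> j"
    using degree_f by (simp add: degree_power_eq)
qed (rule le_imp_power_dvd)

lemma power_f_split: "i \<le> j \<Longrightarrow> f ^ j = f ^ i * f ^ (j - i)"
  by (simp flip: power_add)

lemma Phi_eq_iff: "\<Phi> (Dual a b) = \<Phi> (Dual a' b') \<longleftrightarrow> f ^ N dvd a - a' \<and> f ^ N dvd b - b'"
  unfolding Phi.eq_iff_diff[of "Dual a b"] minus_dual_def dual.sel Phi_kernel ..

text \<open>
  The condition \<open>f^\<mu> dvd f^(N - l) * w\<close> says that the first generator contributes no new torsion: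
  a multiple of it with zero residue is a multiple of \<open>f^(N - l)\<close> times it, whose \<open>u\<close>-part lies in
  \<open>\<langle>f^\<mu>\<rangle>\<close>.
\<close>

context
  fixes l \<mu> :: nat and w :: "'a poly" and C :: "'r set"
  assumes \<mu>_le_l: "\<mu> \<le> l" and l_le_N: "l \<le> N" and no_new_torsion: "f ^ \<mu> dvd f ^ (N - l) * w"
    and C: "C = Idl\<^bsub>R\<^esub> {\<Phi> (Dual (f ^ l) w), \<Phi> (Dual 0 (f ^ \<mu>))}"
begin

lemma code_elements: "C = {\<Phi> (Dual (f ^ l * a) (w * a + f ^ \<mu> * b)) | a b. True}"
proof -
  have product: "Dual (f ^ l) w * P + Dual 0 (f ^ \<mu>) * Q =
      Dual (f ^ l * base_part P)
        (w * base_part P + f ^ \<mu> * (f ^ (l - \<mu>) * eps_part P + base_part Q))" for P Q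
    using power_f_split[OF \<mu>_le_l] by (simp add: times_dual_def plus_dual_def algebra_simps)
  have "\<Phi> (Dual (f ^ l * a) (w * a + f ^ \<mu> * b)) =
      \<Phi> (Dual (f ^ l) w * Dual a 0 + Dual 0 (f ^ \<mu>) * Dual b 0)" for a b
    unfolding product by simp
  then have "{\<Phi> (Dual (f ^ l * a) (w * a + f ^ \<mu> * b)) | a b. True} \<subseteq>
      {\<Phi> (Dual (f ^ l) w * P + Dual 0 (f ^ \<mu>) * Q) | P Q. True}"
    by blast
  moreover have "{\<Phi> (Dual (f ^ l) w * P + Dual 0 (f ^ \<mu>) * Q) | P Q. True} \<subseteq>
      {\<Phi> (Dual (f ^ l * a) (w * a + f ^ \<mu> * b)) | a b. True}"
    unfolding product by blast
  ultimately show ?thesis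
    unfolding C Phi.genideal_pair by (rule equalityI[rotated])
qed

lemma torsion_mem_iff: "\<Phi> (Dual 0 c) \<in> C \<longleftrightarrow> f ^ \<mu> dvd c"
proof
  assume "\<Phi> (Dual 0 c) \<in> C"
  then obtain a b where eq: "\<Phi> (Dual (f ^ l * a) (w * a + f ^ \<mu> * b)) = \<Phi> (Dual 0 c)"
    unfolding code_elements by force
  then have "f ^ l * f ^ (N - l) dvd f ^ l * a" and c: "f ^ N dvd w * a + f ^ \<mu> * b - c"
    unfolding Phi_eq_iff power_f_split[OF l_le_N] by simp_all
  then have "f ^ (N - l) * w dvd a * w"
    by (intro mult_dvd_mono) simp_all
  then have "f ^ \<mu> dvd w * a + f ^ \<mu> * b"
    using dvd_trans[OF no_new_torsion] by (simp add: mult.commute)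
  moreover have "f ^ \<mu> dvd w * a + f ^ \<mu> * b - c"
    using \<mu>_le_l l_le_N by (intro dvd_trans[OF _ c]) (simp add: power_f_dvd_iff)
  ultimately have "f ^ \<mu> dvd (w * a + f ^ \<mu> * b) - (w * a + f ^ \<mu> * b - c)"
    by (rule dvd_diff)
  then show "f ^ \<mu> dvd c"
    by simp
next
  assume "f ^ \<mu> dvd c"
  then obtain b where "c = f ^ \<mu> * b" ..
  then have "\<Phi> (Dual 0 c) = \<Phi> (Dual (f ^ l * 0) (w * 0 + f ^ \<mu> * b))"
    by simp
  then show "\<Phi> (Dual 0 c) \<in> C"
    unfolding code_elements by blast
qed

lemma residue_of_code: "reduction ` C = Idl\<^bsub>S\<^esub> {\<Psi> (f ^ l)}"
proof -
  have "reduction ` C = {reduction (\<Phi> (Dual (f ^ l * a) (w * a + f ^ \<mu> * b))) | a b. True}"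
    unfolding code_elements by blast
  then show ?thesis
    by (simp add: reduction Psi.genideal_single)
qed

lemma torsion_of_code: "{a \<in> carrier S. u_embedding a \<in> C} = Idl\<^bsub>S\<^esub> {\<Psi> (f ^ \<mu>)}"
  unfolding Psi.genideal_single
  by (auto simp: Psi.surj u_embedding torsion_mem_iff dvd_def)

lemma least_torsion_exponent: "(LEAST j. \<Phi> (Dual 0 (f ^ j)) \<in> C) = \<mu>"
  by (rule Least_equality) (simp_all add: torsion_mem_iff power_f_dvd_iff)

text \<open>
  Each codeword is \<open>\<Phi> (f^l a, w a + f^\<mu> b)\<close> for exactly one pair of a remainder \<open>a\<close> modulo
  \<open>f^(N - l)\<close> and a remainder \<open>b\<close> modulo \<open>f^(N - \<mu>)\<close>: changing \<open>a\<close> by a multiple of \<open>f^(N - l)\<close>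
  can be absorbed in \<open>b\<close>.
\<close>

lemma card_code: "card C = card (UNIV :: 'a set) ^ (degree f * (2 * N - l - \<mu>))"
proof -
  let ?word = "\<lambda>(a, b). \<Phi> (Dual (f ^ l * a) (w * a + f ^ \<mu> * b))"
  let ?A = "polys_below (degree (f ^ (N - l))) :: 'a poly set"
  let ?B = "polys_below (degree (f ^ (N - \<mu>))) :: 'a poly set"
  have \<mu>_le_N: "\<mu> \<le> N"
    using \<mu>_le_l l_le_N by simp
  have "inj_on ?word (?A \<times> ?B)"
  proof (rule inj_onI, clarify)
    fix a b a' b'
    assume bounds: "a \<in> ?A" "b \<in> ?B" "a' \<in> ?A" "b' \<in> ?B"
      and eq: "\<Phi> (Dual (f ^ l * a) (w * a + f ^ \<mu> * b)) = \<Phi> (Dual (f ^ l * a') (w * a' + f ^ \<mu> * b'))"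
    then have "f ^ l * f ^ (N - l) dvd f ^ l * (a - a')"
      unfolding Phi_eq_iff power_f_split[OF l_le_N] by (simp add: right_diff_distrib)
    then have a: "a = a'"
      using bounds by (intro polys_below_congruent_eq) auto
    then have "f ^ \<mu> * f ^ (N - \<mu>) dvd f ^ \<mu> * (b - b')"
      using eq unfolding Phi_eq_iff power_f_split[OF \<mu>_le_N] by (simp add: right_diff_distrib)
    then have "b = b'"
      using bounds by (intro polys_below_congruent_eq) auto
    with a show "a = a' \<and> b = b'" ..
  qed
  moreover have "?word ` (?A \<times> ?B) = C"
  proof
    show "?word ` (?A \<times> ?B) \<subseteq> C"
      unfolding code_elements by auto
    show "C \<subseteq> ?word ` (?A \<times> ?B)"
    proof
      fix x assume "x \<in> C"
      then obtain a b where x: "x = \<Phi> (Dual (f ^ l * a) (w * a + f ^ \<mu> * b))"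
        unfolding code_elements by blast
      define a0 where "a0 = a mod f ^ (N - l)"
      obtain a1 where a1: "a = a0 + f ^ (N - l) * a1"
        using mod_mult_div_eq[of a "f ^ (N - l)"] by (metis a0_def)
      obtain e where e: "f ^ (N - l) * w = f ^ \<mu> * e"
        using no_new_torsion by (auto simp: dvd_def)
      define b0 where "b0 = (e * a1 + b) mod f ^ (N - \<mu>)"
      obtain b1 where b1: "e * a1 + b = b0 + f ^ (N - \<mu>) * b1"
        using mod_mult_div_eq[of "e * a1 + b" "f ^ (N - \<mu>)"] by (metis b0_def)
      have "f ^ l * a - f ^ l * a0 = f ^ N * a1"
        by (simp add: a1 power_f_split[OF l_le_N] algebra_simps)
      moreover have "w * a + f ^ \<mu> * b - (w * a0 + f ^ \<mu> * b0) = f ^ N * b1"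
      proof -
        have "w * a + f ^ \<mu> * b - (w * a0 + f ^ \<mu> * b0) =
            (f ^ (N - l) * w) * a1 + f ^ \<mu> * b - f ^ \<mu> * b0"
          by (simp add: a1 algebra_simps)
        also have "\<dots> = f ^ \<mu> * (e * a1 + b) - f ^ \<mu> * b0"
          unfolding e by (simp add: algebra_simps)
        also have "\<dots> = f ^ N * b1"
          by (simp only: b1 power_f_split[OF \<mu>_le_N] distrib_left mult.assoc add_diff_cancel_left')
        finally show ?thesis .
      qed
      ultimately have "x = ?word (a0, b0)"
        unfolding x prod.case Phi_eq_iff by (simp only: dvd_triv_left simp_thms)
      moreover have "(a0, b0) \<in> ?A \<times> ?B"
        unfolding a0_def b0_def by (intro SigmaI mod_in_polys_below power_not_zero f_nonzero)
      ultimately show "x \<in> ?word ` (?A \<times> ?B)"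
        by blast
    qed
  qed
  ultimately have "card C = card (?A \<times> ?B)"
    using card_image[of ?word "?A \<times> ?B"] by simp
  also have "\<dots> = card (UNIV :: 'a set) ^ (degree f * ((N - l) + (N - \<mu>)))"
    by (simp add: card_cartesian_product card_polys_below degree_power_eq algebra_simps
        flip: power_add)
  also have "(N - l) + (N - \<mu>) = 2 * N - l - \<mu>"
    using l_le_N \<mu>_le_N by simp
  finally show ?thesis .
qed

end

text \<open>
  Multiplying the generator by \<open>f^(N - l)\<close> kills its residue and leaves \<open>u f^(N + t - l)\<close> times a
  unit; multiplying it by \<open>u\<close> leaves \<open>u f^l\<close>. So one generator already carries the torsion
  \<open>\<langle>f^min(l, N + t - l)\<rangle>\<close>.
\<close>

lemma unit_twist_eq_pair:
  assumes "t < l" "l \<le> N" and unit: "\<Phi> (Dual c 0) \<in> Units R"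
    and \<mu>: "\<mu> = min l (N + t - l)"
  shows "Idl\<^bsub>R\<^esub> {\<Phi> (Dual (f ^ l) (f ^ t * c))} =
    Idl\<^bsub>R\<^esub> {\<Phi> (Dual (f ^ l) (f ^ t * c)), \<Phi> (Dual 0 (f ^ \<mu>))}"
proof (cases "l \<le> N + t - l")
  case True
  have "Dual 0 (f ^ l) = Dual (f ^ l) (f ^ t * c) * Dual 0 1"
    by (simp add: times_dual_def)
  with True show ?thesis
    by (intro Phi.genideal_single_eq_pair[where c = "Dual 0 1"]) (simp add: \<mu>)
next
  case False
  obtain V where V: "V \<in> carrier R" "\<Phi> (Dual c 0) \<otimes>\<^bsub>R\<^esub> V = \<one>\<^bsub>R\<^esub>"
    using unit by (auto simp: Units_def)
  then obtain d d' where "V = \<Phi> (Dual d d')"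
    by (metis Phi.surj dual.exhaust imageE)
  then have "\<Phi> (Dual (c * d) (c * d')) = \<Phi> (Dual 1 0)"
    using V Phi.hom_simps(2)[of "Dual c 0" "Dual d d'"] Phi.hom_simps(4)
    by (simp add: times_dual_def one_dual_def)
  then have "f ^ N dvd c * d - 1"
    unfolding Phi_eq_iff by simp
  have exponents: "f ^ l * f ^ (N - l) = f ^ N" "f ^ t * f ^ (N - l) = f ^ (N + t - l)"
    using assms by (simp_all add: add.commute flip: power_add)
  have "Dual (f ^ l) (f ^ t * c) * Dual (f ^ (N - l) * d) 0 =
      Dual ((f ^ l * f ^ (N - l)) * d) ((f ^ t * f ^ (N - l)) * (c * d))"
    by (simp add: times_dual_def)
  also have "\<dots> = Dual (f ^ N * d) (f ^ (N + t - l) * (c * d))"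
    by (simp only: exponents)
  finally have product: "Dual (f ^ l) (f ^ t * c) * Dual (f ^ (N - l) * d) 0 =
      Dual (f ^ N * d) (f ^ (N + t - l) * (c * d))" .
  have "f ^ N dvd f ^ (N + t - l) * (1 - c * d)"
    using \<open>f ^ N dvd c * d - 1\<close> by (simp add: dvd_diff_commute)
  then have "\<Phi> (Dual 0 (f ^ \<mu>)) = \<Phi> (Dual (f ^ l) (f ^ t * c) * Dual (f ^ (N - l) * d) 0)"
    unfolding product Phi_eq_iff using False by (simp add: \<mu> min_def right_diff_distrib)
  then show ?thesis
    by (rule Phi.genideal_single_eq_pair)
qed

end

section \<open>Constacyclic codes of length \<open>3p^s\<close>\<close>

lemma power_card_eq_self:
  fixes x :: "'a::{field,finite}"
  shows "x ^ card (UNIV :: 'a set) = x"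
proof (cases "x = 0")
  case False
  let ?T = "ring_of_type_algebra :: 'a ring"
  interpret field ?T
    by (rule field_from_type_algebra)
  interpret G: Group.group "Multiplicative_Group.mult_of ?T"
    by (rule field_mult_group)
  have T: "carrier ?T = UNIV" "\<zero>\<^bsub>?T\<^esub> = 0" "\<one>\<^bsub>?T\<^esub> = 1"
    by (simp_all add: ring_of_type_algebra_def)
  have power: "x [^]\<^bsub>Multiplicative_Group.mult_of ?T\<^esub> k = x ^ k" for k :: nat
    by (induction k) (simp_all add: ring_of_type_algebra_def mult.commute)
  have "x ^ (card (UNIV :: 'a set) - 1) = 1"
    using G.pow_order_eq_1[of x] False unfolding power Coset.order_def by (simp add: T)
  moreover have "x ^ card (UNIV :: 'a set) = x * x ^ (card (UNIV :: 'a set) - 1)"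
    using power_minus_mult[of "card (UNIV :: 'a set)" x] by (simp add: finite_UNIV_card_ge_0 mult.commute)
  ultimately show ?thesis
    by simp
qed (simp add: power_0_left)

lemma frobenius_root:
  fixes x :: "'a::{field,finite}"
  assumes "card (UNIV :: 'a set) = p ^ m" "s = q * m + r" "r \<le> m"
  shows "(x ^ p ^ (m - r)) ^ p ^ s = x"
proof -
  have "m - r + s = m * Suc q"
    using assms by (simp add: algebra_simps)
  then have "(x ^ p ^ (m - r)) ^ p ^ s = x ^ (p ^ m) ^ Suc q"
    by (simp only: power_mult[symmetric] power_add[symmetric])
  also have "y ^ (p ^ m) ^ k = y" for y :: 'a and k
  proof (induction k)
    case (Suc k)
    then show ?case
      using power_card_eq_self[of y] by (simp add: assms power_mult)
  qed simp
  finally show ?thesis .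
qed

lemma frobenius_binomial:
  fixes \<alpha> :: "'a::{field,finite}"
  assumes "prime p" "card (UNIV :: 'a set) = p ^ m"
  shows "(Polynomial.monom 1 k - [:\<alpha>:]) ^ p ^ s = Polynomial.monom 1 (k * p ^ s) - [:\<alpha> ^ p ^ s:]"
proof -
  have "prime CHAR('a)"
    by (rule prime_CHAR_semidom) (rule finite_imp_CHAR_pos, simp)
  \<comment> \<open>Translation by \<open>1\<close> permutes the field, so its cardinality times \<open>1\<close> is \<open>0\<close>.\<close>
  moreover have "(\<Sum>x\<in>UNIV. x + 1 :: 'a) = (\<Sum>x\<in>UNIV. x)"
    by (rule sum.reindex_bij_witness[of _ "\<lambda>x. x - 1" "\<lambda>x. x + 1"]) auto
  then have "CHAR('a) dvd p ^ m"
    using assms by (simp add: sum.distrib of_nat_eq_0_iff_char_dvd flip: of_nat_power)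
  ultimately have char: "CHAR('a) = p"
    using assms by (meson prime_dvd_power primes_dvd_imp_eq)
  let ?f = "Polynomial.monom 1 k - [:\<alpha>:]"
  have "Polynomial.monom 1 k ^ p ^ s = (?f + [:\<alpha>:]) ^ p ^ s"
    by simp
  also have "\<dots> = ?f ^ p ^ s + [:\<alpha>:] ^ p ^ s"
    using assms by (intro freshmans_dream') (simp_all add: char)
  finally show ?thesis
    by (simp add: eq_diff_eq monom_power poly_const_pow)
qed

text \<open>
  The power \<open>f^e\<close> equals \<open>v(\<alpha>\<^sub>3 + \<alpha>\<^sub>4 u)\<close> in \<open>R\<close> and \<open>v\<alpha>\<^sub>3\<close> in \<open>S\<close>. So \<open>v\<close> can be eliminated from both
  rings, at the price of the relation \<open>f^(2e) = 0\<close>.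
\<close>

lemma constacyclic_presentation:
  fixes \<alpha>\<^sub>0 \<alpha>\<^sub>1 \<alpha>\<^sub>3 \<alpha>\<^sub>4 :: "'a::{field,finite}"
  assumes "f = Polynomial.monom 1 3 - [:\<alpha>\<^sub>0:]"
    and power: "f ^ e = Polynomial.monom 1 n - [:\<alpha>\<^sub>1:]" and "\<alpha>\<^sub>3 \<noteq> 0"
    and \<gamma>: "\<gamma> = scalar \<alpha>\<^sub>1 + scalar \<alpha>\<^sub>3 * coeff_v + scalar \<alpha>\<^sub>4 * coeff_u * coeff_v"
    and \<delta>: "\<delta> = of_base \<alpha>\<^sub>1 + of_base \<alpha>\<^sub>3 * eps"
  shows "dual_presentation (constacyclic_ring n \<gamma>) (\<lambda>A. residue_class n \<gamma> (poly_of_dual A))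
    (constacyclic_ring n \<delta>) (\<lambda>a. residue_class n \<delta> (map_poly of_base a))
    f (2 * e) (psi_u n \<gamma>) (u_times n \<gamma>)"
proof -
  let ?R = "constacyclic_ring n \<gamma>" and ?S = "constacyclic_ring n \<delta>"
  have base_\<gamma>: "base_part \<gamma> = \<delta>"
    by (simp add: \<gamma> \<delta> scalar_def coeff_v_def coeff_u_def)
  have square: "(f ^ e)\<^sup>2 = f ^ (2 * e)"
    by (simp add: mult.commute flip: power_mult)
  have "Polynomial.monom 1 n - [:\<gamma>:] = map_poly scalar (f ^ e)
      - [:scalar \<alpha>\<^sub>3 * coeff_v + scalar \<alpha>\<^sub>4 * coeff_u * coeff_v:]"
    by (simp add: power \<gamma> map_poly_diff_hom scalar_def map_poly_monom map_poly_pCons)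
  note over_R = perturbation_over_dual_dual[OF \<open>\<alpha>\<^sub>3 \<noteq> 0\<close> this, unfolded square]
  have "Polynomial.monom 1 n - [:\<delta>:] = map_poly of_base (f ^ e) - [:of_base \<alpha>\<^sub>3 * eps:]"
    by (simp add: power \<delta> map_poly_diff_hom map_poly_monom map_poly_pCons)
  note over_S = perturbation_over_dual[OF \<open>\<alpha>\<^sub>3 \<noteq> 0\<close> this, unfolded square]
  interpret R: type_ring_surjection ?R "residue_class n \<gamma>"
    by (rule residue_class_surjection)
  interpret S: type_ring_surjection ?S "residue_class n \<delta>"
    by (rule residue_class_surjection)
  have "type_ring_surjection ?R (\<lambda>A. residue_class n \<gamma> (poly_of_dual A))"
  proof -
    interpret T: cring "ring_of_type_algebra :: 'a poly dual ring"
      by (rule cring_from_type_algebra)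
    show ?thesis
    proof
      show "(\<lambda>A. residue_class n \<gamma> (poly_of_dual A)) \<in> ring_hom ring_of_type_algebra ?R"
        by (rule ring_hom_memI)
          (simp_all add: ring_of_type_algebra_def poly_of_dual_hom R.hom_simps)
      show "carrier ?R = range (\<lambda>A. residue_class n \<gamma> (poly_of_dual A))"
        using over_R(1) by (auto simp: R.surj image_iff residue_class_eq_iff)
    qed
  qed
  moreover have "type_ring_surjection ?S (\<lambda>a. residue_class n \<delta> (map_poly of_base a))"
  proof -
    interpret T: cring "ring_of_type_algebra :: 'a poly ring"
      by (rule cring_from_type_algebra)
    show ?thesis
    proof
      show "(\<lambda>a. residue_class n \<delta> (map_poly of_base a)) \<in> ring_hom ring_of_type_algebra ?S"
        by (rule ring_hom_memI)
          (simp_all add: ring_of_type_algebra_def map_poly_add_hom map_poly_mult_hom S.hom_simps)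
      show "carrier ?S = range (\<lambda>a. residue_class n \<delta> (map_poly of_base a))"
        using over_S(1) by (auto simp: S.surj image_iff residue_class_eq_iff)
    qed
  qed
  moreover have "dual_presentation_axioms ?R (\<lambda>A. residue_class n \<gamma> (poly_of_dual A))
    ?S (\<lambda>a. residue_class n \<delta> (map_poly of_base a)) f (2 * e) (psi_u n \<gamma>) (u_times n \<gamma>)"
  proof
    have "coeff f 3 = 1"
      by (simp add: assms(1) coeff_pCons split: nat.split)
    then show "degree f > 0"
      using le_degree[of f 3] by simp
    show "residue_class n \<gamma> (poly_of_dual (Dual a b)) = \<zero>\<^bsub>?R\<^esub>
        \<longleftrightarrow> f ^ (2 * e) dvd a \<and> f ^ (2 * e) dvd b" for a b
      using over_R(2)[of a b] residue_class_eq_iff[of n \<gamma> _ 0] by (simp add: R.hom_simps(3))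
    show "residue_class n \<delta> (map_poly of_base a) = \<zero>\<^bsub>?S\<^esub> \<longleftrightarrow> f ^ (2 * e) dvd a" for a
      using over_S(2)[of a] residue_class_eq_iff[of n \<delta> _ 0] by (simp add: S.hom_simps(3))
    have "map_poly base_part (poly_of_dual (Dual a b)) = map_poly of_base a" for a b :: "'a poly"
      by (rule poly_eqI) (simp add: coeff_map_poly coeff_poly_of_dual, simp add: of_base_def)
    then show "psi_u n \<gamma> (residue_class n \<gamma> (poly_of_dual (Dual a b))) =
        residue_class n \<delta> (map_poly of_base a)" for a b
      by (simp add: psi_u_residue_class base_\<gamma>)
    have "[:eps:] * map_poly of_base (map_poly of_base b) = poly_of_dual (Dual 0 b)"
      for b :: "'a poly"
      by (rule poly_eqI) (simp add: coeff_map_poly coeff_poly_of_dual,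
          simp add: of_base_def eps_def dual_defs)
    then show "u_times n \<gamma> (residue_class n \<delta> (map_poly of_base b)) =
        residue_class n \<gamma> (poly_of_dual (Dual 0 b))" for b
      using u_times_residue_class[of n \<gamma> "map_poly of_base b"] by (simp add: base_\<gamma>)
  qed
  ultimately show ?thesis
    by (rule dual_presentation.intro)
qed

theorem theorem4p3:
  fixes p m s q\<^sub>0 r\<^sub>0 n :: nat
    and \<alpha>\<^sub>0 \<alpha>\<^sub>1 \<alpha>\<^sub>3 \<alpha>\<^sub>4 :: "'a::{field,finite}"
    and \<gamma> :: "'a dual dual"
    and R :: "'a dual dual poly set ring"
    and S :: "'a dual poly set ring"
    and U Y :: "'a dual dual poly set"
    and y :: "'a dual poly set"
    and C :: "'a dual dual poly set set"
  assumes "prime p" and "p \<noteq> 3" and "m > 0" and "s > 0" and "card (UNIV :: 'a set) = p ^ m"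
    and "s = q\<^sub>0 * m + r\<^sub>0" and "r\<^sub>0 \<le> m - 1"
    and "\<alpha>\<^sub>1 \<noteq> 0" and "\<alpha>\<^sub>3 \<noteq> 0" and "\<alpha>\<^sub>4 \<noteq> 0"
    and "\<alpha>\<^sub>0 = \<alpha>\<^sub>1 ^ (p ^ (m - r\<^sub>0))"
    and "\<gamma> = scalar \<alpha>\<^sub>1 + scalar \<alpha>\<^sub>3 * coeff_v + scalar \<alpha>\<^sub>4 * coeff_u * coeff_v"
    and "\<nexists>c. \<gamma> = c ^ 3"
    and "n = 3 * p ^ s"
    and "R = constacyclic_ring n \<gamma>"
    and "S = constacyclic_ring n (of_base \<alpha>\<^sub>1 + of_base \<alpha>\<^sub>3 * eps)"
    and "U = residue_class n \<gamma> [:coeff_u:]"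
    and "Y = residue_class n \<gamma> (Polynomial.monom 1 3 - [:scalar \<alpha>\<^sub>0:])"
    and "y = residue_class n (of_base \<alpha>\<^sub>1 + of_base \<alpha>\<^sub>3 * eps)
               (Polynomial.monom 1 3 - [:of_base \<alpha>\<^sub>0:])"
    and "ideal C R"
  shows
    "(C = Idl\<^bsub>R\<^esub> {\<zero>\<^bsub>R\<^esub>} \<longrightarrow>
         Res n \<gamma> C = Idl\<^bsub>S\<^esub> {\<zero>\<^bsub>S\<^esub>} \<and> Tor n \<gamma> C = Idl\<^bsub>S\<^esub> {\<zero>\<^bsub>S\<^esub>} \<and> card C = 1) \<and>
     (C = Idl\<^bsub>R\<^esub> {\<one>\<^bsub>R\<^esub>} \<longrightarrow>
         Res n \<gamma> C = Idl\<^bsub>S\<^esub> {\<one>\<^bsub>S\<^esub>} \<and> Tor n \<gamma> C = Idl\<^bsub>S\<^esub> {\<one>\<^bsub>S\<^esub>} \<and>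
         card C = p ^ (12 * m * p ^ s)) \<and>
     (\<forall>l. l \<le> 2 * p ^ s - 1 \<and> C = Idl\<^bsub>R\<^esub> {U \<otimes>\<^bsub>R\<^esub> Y [^]\<^bsub>R\<^esub> l} \<longrightarrow>
         Res n \<gamma> C = Idl\<^bsub>S\<^esub> {\<zero>\<^bsub>S\<^esub>} \<and> Tor n \<gamma> C = Idl\<^bsub>S\<^esub> {y [^]\<^bsub>S\<^esub> l} \<and>
         card C = p ^ (3 * m * (2 * p ^ s - l))) \<and>
     (\<forall>l. 1 \<le> l \<and> l \<le> 2 * p ^ s - 1 \<and> C = Idl\<^bsub>R\<^esub> {Y [^]\<^bsub>R\<^esub> l} \<longrightarrow>
         Res n \<gamma> C = Idl\<^bsub>S\<^esub> {y [^]\<^bsub>S\<^esub> l} \<and>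
         Tor n \<gamma> C = Idl\<^bsub>S\<^esub> {y [^]\<^bsub>S\<^esub> (LEAST j::nat. U \<otimes>\<^bsub>R\<^esub> Y [^]\<^bsub>R\<^esub> j \<in> C)} \<and>
         card C = p ^ (6 * m * (2 * p ^ s - l))) \<and>
     (\<forall>l t z. 1 \<le> l \<and> l \<le> 2 * p ^ s - 1 \<and> t < l \<and> unit_expansion n \<gamma> \<alpha>\<^sub>0 UNIV z \<and>
         C = Idl\<^bsub>R\<^esub> {Y [^]\<^bsub>R\<^esub> l \<oplus>\<^bsub>R\<^esub> U \<otimes>\<^bsub>R\<^esub> Y [^]\<^bsub>R\<^esub> t \<otimes>\<^bsub>R\<^esub> z} \<longrightarrow>
         Res n \<gamma> C = Idl\<^bsub>S\<^esub> {y [^]\<^bsub>S\<^esub> l} \<and>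
         Tor n \<gamma> C = Idl\<^bsub>S\<^esub> {y [^]\<^bsub>S\<^esub> (LEAST j::nat. U \<otimes>\<^bsub>R\<^esub> Y [^]\<^bsub>R\<^esub> j \<in> C)} \<and>
         (LEAST j::nat. U \<otimes>\<^bsub>R\<^esub> Y [^]\<^bsub>R\<^esub> j \<in> C) = min l (2 * p ^ s + t - l) \<and>
         (real l \<le> real (p ^ s) + real t / 2 \<longrightarrow> card C = p ^ (6 * m * (2 * p ^ s - l))) \<and>
         (real (p ^ s) + real t / 2 < real l \<longrightarrow> card C = p ^ (3 * m * (2 * p ^ s - t)))) \<and>
     (\<forall>l t \<mu> z. 1 \<le> l \<and> l \<le> 2 * p ^ s - 1 \<and> t < l \<and>
         (z = \<zero>\<^bsub>R\<^esub> \<or> unit_expansion n \<gamma> \<alpha>\<^sub>0 {\<kappa>. int \<kappa> \<le> int \<mu> - int t - 1} z) \<and>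
         \<mu> < (if z = \<zero>\<^bsub>R\<^esub> then l else min l (2 * p ^ s + t - l)) \<and>
         C = Idl\<^bsub>R\<^esub> {Y [^]\<^bsub>R\<^esub> l \<oplus>\<^bsub>R\<^esub> U \<otimes>\<^bsub>R\<^esub> Y [^]\<^bsub>R\<^esub> t \<otimes>\<^bsub>R\<^esub> z, U \<otimes>\<^bsub>R\<^esub> Y [^]\<^bsub>R\<^esub> \<mu>} \<longrightarrow>
         Res n \<gamma> C = Idl\<^bsub>S\<^esub> {y [^]\<^bsub>S\<^esub> l} \<and> Tor n \<gamma> C = Idl\<^bsub>S\<^esub> {y [^]\<^bsub>S\<^esub> \<mu>} \<and>
         card C = p ^ (3 * m * (4 * p ^ s - l - \<mu>)))"
proof -
  define f where "f = Polynomial.monom 1 3 - [:\<alpha>\<^sub>0:]"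
  define \<delta> where "\<delta> = of_base \<alpha>\<^sub>1 + of_base \<alpha>\<^sub>3 * eps"
  define \<Phi> where "\<Phi> = (\<lambda>A. residue_class n \<gamma> (poly_of_dual A))"
  define \<Psi> where "\<Psi> = (\<lambda>a. residue_class n \<delta> (map_poly of_base a))"
  let ?N = "2 * p ^ s"
  have "r\<^sub>0 \<le> m"
    using assms(3,7) by simp
  then have "\<alpha>\<^sub>0 ^ p ^ s = \<alpha>\<^sub>1"
    unfolding \<open>\<alpha>\<^sub>0 = _\<close> by (rule frobenius_root[OF assms(5,6)])
  then have power: "f ^ p ^ s = Polynomial.monom 1 n - [:\<alpha>\<^sub>1:]"
    using frobenius_binomial[OF assms(1,5)] by (simp add: f_def \<open>n = _\<close>)
  interpret dual_presentation R \<Phi> S \<Psi> f ?N "psi_u n \<gamma>" "u_times n \<gamma>"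
    unfolding \<open>R = _\<close> \<open>S = _\<close> \<Phi>_def \<Psi>_def \<delta>_def
    by (rule constacyclic_presentation[OF f_def power assms(9,12) refl])
  have degree_f: "degree f = 3"
    unfolding f_def diff_conv_add_uminus
    by (subst degree_add_eq_left) (simp_all add: degree_monom_eq)
  have q: "card (UNIV :: 'a set) ^ k = p ^ (m * k)" for k
    by (simp add: assms(5) power_mult)
  have Y: "Y = \<Phi> (Dual f 0)"
    by (simp add: \<open>Y = _\<close> \<Phi>_def f_def poly_of_dual_def map_poly_diff_hom scalar_def map_poly_monom
        map_poly_pCons)
  have U: "U = \<Phi> (Dual 0 1)"
    by (simp add: \<open>U = _\<close> \<Phi>_def poly_of_dual_def scalar_def)
  have y: "y = \<Psi> f"
    by (simp add: \<open>y = _\<close> \<Psi>_def \<delta>_def f_def map_poly_diff_hom map_poly_monom map_poly_pCons)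
  have Dual_power: "Dual f 0 ^ k = Dual (f ^ k) 0" for k
    by (induction k) (simp_all add: one_dual_def times_dual_def)
  have Y_power: "Y [^]\<^bsub>R\<^esub> k = \<Phi> (Dual (f ^ k) 0)" for k :: nat
    by (simp add: Y Dual_power flip: Phi.hom_power)
  have UY: "U \<otimes>\<^bsub>R\<^esub> Y [^]\<^bsub>R\<^esub> k = \<Phi> (Dual 0 (f ^ k))" for k :: nat
    by (simp add: U Y_power Phi.hom_simps(2)[symmetric]) (simp add: times_dual_def)
  have y_power: "y [^]\<^bsub>S\<^esub> k = \<Psi> (f ^ k)" for k :: nat
    by (simp add: y Psi.hom_power)
  have twist: "Y [^]\<^bsub>R\<^esub> l \<oplus>\<^bsub>R\<^esub> U \<otimes>\<^bsub>R\<^esub> Y [^]\<^bsub>R\<^esub> t \<otimes>\<^bsub>R\<^esub> \<Phi> (Dual c 0) = \<Phi> (Dual (f ^ l) (f ^ t * c))"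
    for l t :: nat and c
    unfolding UY unfolding Y_power Phi.hom_simps(1,2)[symmetric] by (simp add: times_dual_def plus_dual_def)
  have expansion: "\<exists>c. z = \<Phi> (Dual c 0) \<and> \<Phi> (Dual c 0) \<in> Units R"
    if "unit_expansion n \<gamma> \<alpha>\<^sub>0 A z" for A z
    using that unfolding unit_expansion_def \<open>R = _\<close> \<Phi>_def poly_of_dual_def by auto
  have \<Psi>_0: "\<Psi> (f ^ ?N) = \<zero>\<^bsub>S\<^esub>" and \<Phi>_0: "\<Phi> (Dual (f ^ ?N) 0) = \<zero>\<^bsub>R\<^esub>" "\<Phi> (Dual 0 (f ^ ?N)) = \<zero>\<^bsub>R\<^esub>"
    by (simp_all add: Psi_kernel Phi_kernel)
  have \<Psi>_1: "\<Psi> (f ^ 0) = \<one>\<^bsub>S\<^esub>"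
    using Psi.hom_simps(4) by simp
  have \<Phi>_1: "\<Phi> (Dual (f ^ 0) 0) = \<one>\<^bsub>R\<^esub>"
    using Phi.hom_simps(4) by (simp add: one_dual_def)
  \<comment> \<open>Each type of code is an instance, with residue \<open>\<langle>0\<rangle>\<close> given by \<open>l = 2p^s\<close>.\<close>
  have code: "Res n \<gamma> C = Idl\<^bsub>S\<^esub> {\<Psi> (f ^ l)}" "Tor n \<gamma> C = Idl\<^bsub>S\<^esub> {\<Psi> (f ^ \<mu>)}"
    "card C = p ^ (3 * m * (4 * p ^ s - l - \<mu>))" "(LEAST j. U \<otimes>\<^bsub>R\<^esub> Y [^]\<^bsub>R\<^esub> j \<in> C) = \<mu>"
    if "\<mu> \<le> l" "l \<le> ?N" "f ^ \<mu> dvd f ^ (?N - l) * w"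
      "C = Idl\<^bsub>R\<^esub> {\<Phi> (Dual (f ^ l) w), \<Phi> (Dual 0 (f ^ \<mu>))}" for l \<mu> w
  proof -
    have S: "S = constacyclic_ring n (base_part \<gamma>)"
      by (simp add: \<open>S = _\<close> \<open>\<gamma> = _\<close> scalar_def coeff_v_def coeff_u_def)
    show "Res n \<gamma> C = Idl\<^bsub>S\<^esub> {\<Psi> (f ^ l)}"
      unfolding Res_def by (rule residue_of_code[OF that])
    show "Tor n \<gamma> C = Idl\<^bsub>S\<^esub> {\<Psi> (f ^ \<mu>)}"
      unfolding Tor_def S[symmetric] by (rule torsion_of_code[OF that])
    show "card C = p ^ (3 * m * (4 * p ^ s - l - \<mu>))"
      unfolding card_code[OF that] degree_f q by (simp add: mult.assoc mult.left_commute)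
    show "(LEAST j. U \<otimes>\<^bsub>R\<^esub> Y [^]\<^bsub>R\<^esub> j \<in> C) = \<mu>"
      unfolding UY by (rule least_torsion_exponent[OF that])
  qed
  have torsion_bound: "f ^ \<mu> dvd f ^ (?N - l) * (f ^ t * c)"
    if "l \<le> ?N" "\<mu> \<le> ?N + t - l" for l t \<mu> c
    using that by (simp add: power_f_dvd_iff dvd_mult2 flip: mult.assoc power_add)
  show ?thesis
  proof (intro conjI allI impI; (elim conjE)?)
    assume "C = Idl\<^bsub>R\<^esub> {\<zero>\<^bsub>R\<^esub>}"
    then have "C = Idl\<^bsub>R\<^esub> {\<Phi> (Dual (f ^ ?N) 0), \<Phi> (Dual 0 (f ^ ?N))}"
      by (simp add: \<Phi>_0)
    note code = code[OF _ _ _ this, simplified \<Psi>_0]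
    show "Res n \<gamma> C = Idl\<^bsub>S\<^esub> {\<zero>\<^bsub>S\<^esub>}"
      and "Tor n \<gamma> C = Idl\<^bsub>S\<^esub> {\<zero>\<^bsub>S\<^esub>}"
      and "card C = 1"
      using code(1-3) by simp_all
  next
    assume C: "C = Idl\<^bsub>R\<^esub> {\<one>\<^bsub>R\<^esub>}"
    have "C = Idl\<^bsub>R\<^esub> {\<Phi> (Dual (f ^ 0) 0), \<Phi> (Dual 0 (f ^ 0))}"
      unfolding C \<Phi>_1[symmetric]
      by (rule Phi.genideal_single_eq_pair[of _ _ "Dual 0 1"]) (simp add: times_dual_def)
    note code = code[OF _ _ _ this, unfolded \<Psi>_1]
    show "Res n \<gamma> C = Idl\<^bsub>S\<^esub> {\<one>\<^bsub>S\<^esub>}"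
      and "Tor n \<gamma> C = Idl\<^bsub>S\<^esub> {\<one>\<^bsub>S\<^esub>}"
      and "card C = p ^ (12 * m * p ^ s)"
      using code(1-3) by (simp_all add: mult.assoc mult.left_commute)
  next
    fix l assume l: "l \<le> ?N - 1" and C: "C = Idl\<^bsub>R\<^esub> {U \<otimes>\<^bsub>R\<^esub> Y [^]\<^bsub>R\<^esub> l}"
    have "C = Idl\<^bsub>R\<^esub> {\<Phi> (Dual 0 (f ^ l)), \<Phi> (Dual (f ^ ?N) 0)}"
      unfolding C UY
      by (rule Phi.genideal_single_eq_pair[of _ _ 0])
        (simp add: \<Phi>_0 Phi.hom_simps(3))
    then have "C = Idl\<^bsub>R\<^esub> {\<Phi> (Dual (f ^ ?N) 0), \<Phi> (Dual 0 (f ^ l))}"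
      by (simp only: insert_commute)
    note code = code[OF _ _ _ this, unfolded \<Psi>_0]
    show "Res n \<gamma> C = Idl\<^bsub>S\<^esub> {\<zero>\<^bsub>S\<^esub>}"
      and "Tor n \<gamma> C = Idl\<^bsub>S\<^esub> {y [^]\<^bsub>S\<^esub> l}"
      and "card C = p ^ (3 * m * (2 * p ^ s - l))"
      using code(1-3) l by (simp_all add: y_power)
  next
    fix l assume l: "1 \<le> l" "l \<le> ?N - 1" and C: "C = Idl\<^bsub>R\<^esub> {Y [^]\<^bsub>R\<^esub> l}"
    have "C = Idl\<^bsub>R\<^esub> {\<Phi> (Dual (f ^ l) 0), \<Phi> (Dual 0 (f ^ l))}"
      unfolding C Y_power
      by (rule Phi.genideal_single_eq_pair[of _ _ "Dual 0 1"]) (simp add: times_dual_def)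
    note code = code[OF order_refl _ _ this]
    have exponent: "3 * m * (4 * p ^ s - l - l) = 6 * m * (2 * p ^ s - l)"
    proof -
      have "4 * p ^ s - l - l = 2 * (2 * p ^ s - l)"
        by simp
      then show ?thesis
        by (simp only:)
    qed
    have "l \<le> ?N" "f ^ l dvd f ^ (?N - l) * 0"
      using l by simp_all
    note code = code[OF this]
    show "Res n \<gamma> C = Idl\<^bsub>S\<^esub> {y [^]\<^bsub>S\<^esub> l}"
      using code(1) by (simp only: y_power)
    show "Tor n \<gamma> C = Idl\<^bsub>S\<^esub> {y [^]\<^bsub>S\<^esub> (LEAST j::nat. U \<otimes>\<^bsub>R\<^esub> Y [^]\<^bsub>R\<^esub> j \<in> C)}"
      using code(2) by (simp only: y_power code(4))
    show "card C = p ^ (6 * m * (2 * p ^ s - l))"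
      using code(3) by (simp only: exponent)
  next
    fix l t z
    assume l: "1 \<le> l" "l \<le> ?N - 1" "t < l" and z: "unit_expansion n \<gamma> \<alpha>\<^sub>0 UNIV z"
      and C: "C = Idl\<^bsub>R\<^esub> {Y [^]\<^bsub>R\<^esub> l \<oplus>\<^bsub>R\<^esub> U \<otimes>\<^bsub>R\<^esub> Y [^]\<^bsub>R\<^esub> t \<otimes>\<^bsub>R\<^esub> z}"
    define \<mu> where "\<mu> = min l (?N + t - l)"
    obtain c where c: "z = \<Phi> (Dual c 0)" "\<Phi> (Dual c 0) \<in> Units R"
      using expansion[OF z] by blast
    have "C = Idl\<^bsub>R\<^esub> {\<Phi> (Dual (f ^ l) (f ^ t * c)), \<Phi> (Dual 0 (f ^ \<mu>))}"
      unfolding C c(1) twist using l c(2) by (intro unit_twist_eq_pair) (auto simp: \<mu>_def)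
    note code = code[OF _ _ torsion_bound this]
    have \<mu>: "\<mu> \<le> l" "l \<le> ?N" "\<mu> \<le> ?N + t - l"
      using l by (auto simp: \<mu>_def)
    have small: "3 * m * (4 * p ^ s - l - \<mu>) = 6 * m * (2 * p ^ s - l)"
      if "real l \<le> real (p ^ s) + real t / 2"
    proof -
      have "real (2 * l) \<le> real (2 * p ^ s + t)"
        using that by simp
      then have "2 * l \<le> 2 * p ^ s + t"
        by (simp only: of_nat_le_iff)
      then have "\<mu> = l"
        unfolding \<mu>_def by linarith
      then have "4 * p ^ s - l - \<mu> = 2 * (2 * p ^ s - l)"
        by simp
      then show ?thesis
        by (simp only:)
    qed
    have large: "3 * m * (4 * p ^ s - l - \<mu>) = 3 * m * (2 * p ^ s - t)"
      if "real (p ^ s) + real t / 2 < real l"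
    proof -
      have "real (2 * p ^ s + t) < real (2 * l)"
        using that by simp
      then have "2 * p ^ s + t < 2 * l"
        by (simp only: of_nat_less_iff)
      then have "\<mu> = 2 * p ^ s + t - l"
        unfolding \<mu>_def by linarith
      then have "4 * p ^ s - l - \<mu> = 2 * p ^ s - t"
        using l by linarith
      then show ?thesis
        by simp
    qed
    show "Res n \<gamma> C = Idl\<^bsub>S\<^esub> {y [^]\<^bsub>S\<^esub> l}"
      using code(1) \<mu> by (simp add: y_power)
    show "Tor n \<gamma> C = Idl\<^bsub>S\<^esub> {y [^]\<^bsub>S\<^esub> (LEAST j::nat. U \<otimes>\<^bsub>R\<^esub> Y [^]\<^bsub>R\<^esub> j \<in> C)}"
      using code(2,4) \<mu> by (simp add: y_power)
    show "(LEAST j::nat. U \<otimes>\<^bsub>R\<^esub> Y [^]\<^bsub>R\<^esub> j \<in> C) = min l (2 * p ^ s + t - l)"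
      using code(4) \<mu> by (simp add: \<mu>_def)
    show "card C = p ^ (6 * m * (2 * p ^ s - l))" if "real l \<le> real (p ^ s) + real t / 2"
      using code(3)[OF \<mu>(1,2) \<mu>(2,3)] small[OF that] by (simp only:)
    show "card C = p ^ (3 * m * (2 * p ^ s - t))" if "real (p ^ s) + real t / 2 < real l"
      using code(3)[OF \<mu>(1,2) \<mu>(2,3)] large[OF that] by (simp only:)
  next
    fix l t \<mu> z
    assume l: "1 \<le> l" "l \<le> ?N - 1" "t < l"
      and z: "z = \<zero>\<^bsub>R\<^esub> \<or> unit_expansion n \<gamma> \<alpha>\<^sub>0 {\<kappa>. int \<kappa> \<le> int \<mu> - int t - 1} z"
      and \<mu>: "\<mu> < (if z = \<zero>\<^bsub>R\<^esub> then l else min l (2 * p ^ s + t - l))"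
      and C: "C = Idl\<^bsub>R\<^esub> {Y [^]\<^bsub>R\<^esub> l \<oplus>\<^bsub>R\<^esub> U \<otimes>\<^bsub>R\<^esub> Y [^]\<^bsub>R\<^esub> t \<otimes>\<^bsub>R\<^esub> z, U \<otimes>\<^bsub>R\<^esub> Y [^]\<^bsub>R\<^esub> \<mu>}"
    have "\<exists>c. z = \<Phi> (Dual c 0) \<and> f ^ \<mu> dvd f ^ (?N - l) * (f ^ t * c)"
    proof (cases "z = \<zero>\<^bsub>R\<^esub>")
      case True
      then have "z = \<Phi> (Dual 0 0)"
        using Phi_kernel[of 0 0] by simp
      then show ?thesis
        by (intro exI[of _ 0]) simp
    next
      case False
      then show ?thesis
        using z \<mu> l expansion torsion_bound[of l \<mu> t] by auto
    qed
    then obtain c where c: "z = \<Phi> (Dual c 0)" "f ^ \<mu> dvd f ^ (?N - l) * (f ^ t * c)"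
      by blast
    have "\<mu> \<le> l"
      using \<mu> by (auto split: if_splits)
    note code = code[OF this _ c(2) C[unfolded c(1) twist, unfolded UY]]
    show "Res n \<gamma> C = Idl\<^bsub>S\<^esub> {y [^]\<^bsub>S\<^esub> l}"
      and "Tor n \<gamma> C = Idl\<^bsub>S\<^esub> {y [^]\<^bsub>S\<^esub> \<mu>}"
      and "card C = p ^ (3 * m * (4 * p ^ s - l - \<mu>))"
      using code l by (simp_all add: y_power)
  qed
qed

end
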